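(* If $G$ is a graph such that $\gamma_{2,t}(G)=\max\{\gamma_r(G),2\rho(G)\}$, then for any noncomplete graph $H$, $$\gamma_r(G\circ H)=\gamma_{2,t}(G).$$
   Context: Graphs are finite, simple and undirected. For a graph $G$, a function $f:V(G)\to\{0,1,2\}$ has weight $w(f)=\sum_{v\in V(G)}f(v)$; a vertex $v$ is undefended with respect to $f$ if $f(v)=0$ and $f(u)=0$ for every $u$ adjacent to $v$. The function $f$ is a weak Roman dominating function (WRDF) on $G$ if for every $v$ with $f(v)=0$ there is a vertex $u$ adjacent to $v$ with $f(u)\in\{1,2\}$ such that the function $f'$ defined by $f'(v)=1$, $f'(u)=f(u)-1$ and $f'(z)=f(z)$ for $z\notin\{u,v\}$ has no undefended vertices. The weak Roman domination number $\gamma_r(G)$ is the minimum weight of a WRDF on $G$. The lexicographic product $G\circ H$ has vertex set $V(G)\times V(H)$, and $(u,v)$ and $(x,y)$ are adjacent iff $ux\in E(G)$, or $u=x$ and $vy\in E(H)$. The double total domination number $\gamma_{2,t}(G)$ is defined only for graphs $G$ of minimum degree at least two (so the hypothesis presupposes this), as the minimum cardinality of a set $S\subseteq V(G)$ such that every vertex of $G$ is adjacent to at least two vertices of $S$. A $2$-packing of $G$ is a set $X\subseteq V(G)$ with $N[u]\cap N[v]=\emptyset$ for every pair of different vertices $u,v\in X$, where $N[u]$ is the closed neighbourhood of $u$; $\rho(G)$ is the maximum cardinality of a $2$-packing. *)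

theory Defs
  imports "Graph_Theory.Graph_Theory"
begin

text \<open>
  Finite simple undirected graphs are the symmetric digraphs of locale \<^locale>\<open>pair_graph\<close>:
  an edge \<open>uv\<close> is the pair of arcs \<open>(u,v)\<close> and \<open>(v,u)\<close>, so the degree of a vertex is its
  out-degree. The vertex set may be empty.
\<close>

section \<open>Weak Roman domination\<close>

definition undefended :: "'a pair_pre_digraph \<Rightarrow> ('a \<Rightarrow> nat) \<Rightarrow> 'a \<Rightarrow> bool" where
  "undefended G f v \<longleftrightarrow> v \<in> pverts G \<and> f v = 0 \<and> (\<forall>u. v \<rightarrow>\<^bsub>G\<^esub> u \<longrightarrow> f u = 0)"

text \<open>The values of the function outside the vertex set are arbitrary and play no role.\<close>

definition weak_roman_dominating :: "'a pair_pre_digraph \<Rightarrow> ('a \<Rightarrow> nat) \<Rightarrow> bool" where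
  "weak_roman_dominating G f \<longleftrightarrow>
     f \<in> pverts G \<rightarrow> {0, 1, 2} \<and>
     (\<forall>v \<in> pverts G. f v = 0 \<longrightarrow>
        (\<exists>u. v \<rightarrow>\<^bsub>G\<^esub> u \<and> f u \<in> {1, 2} \<and>
             \<not> (\<exists>z. undefended G (f(v := 1, u := f u - 1)) z)))"

definition weight :: "'a pair_pre_digraph \<Rightarrow> ('a \<Rightarrow> nat) \<Rightarrow> nat" where
  "weight G f = (\<Sum>v \<in> pverts G. f v)"

definition weak_roman_number :: "'a pair_pre_digraph \<Rightarrow> nat" where
  "weak_roman_number G = (LEAST k. \<exists>f. weak_roman_dominating G f \<and> weight G f = k)"

section \<open>Double total domination\<close>

definition double_total_dominating :: "'a pair_pre_digraph \<Rightarrow> 'a set \<Rightarrow> bool" where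
  "double_total_dominating G S \<longleftrightarrow>
     S \<subseteq> pverts G \<and> (\<forall>v \<in> pverts G. 2 \<le> card {u \<in> S. v \<rightarrow>\<^bsub>G\<^esub> u})"

text \<open>Only meaningful for graphs of minimum degree at least two: otherwise there is no double
  total dominating set, and the value is unspecified.\<close>

definition double_total_number :: "'a pair_pre_digraph \<Rightarrow> nat" where
  "double_total_number G = (LEAST k. \<exists>S. double_total_dominating G S \<and> card S = k)"

section \<open>Two-packings\<close>

definition closed_neighbourhood :: "'a pair_pre_digraph \<Rightarrow> 'a \<Rightarrow> 'a set" where
  "closed_neighbourhood G u = insert u {v. u \<rightarrow>\<^bsub>G\<^esub> v}"

definition two_packing :: "'a pair_pre_digraph \<Rightarrow> 'a set \<Rightarrow> bool" where
  "two_packing G X \<longleftrightarrow>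
     X \<subseteq> pverts G \<and>
     (\<forall>u \<in> X. \<forall>v \<in> X. u \<noteq> v \<longrightarrow> closed_neighbourhood G u \<inter> closed_neighbourhood G v = {})"

definition packing_number :: "'a pair_pre_digraph \<Rightarrow> nat" where
  "packing_number G = Max {card X | X. two_packing G X}"

section \<open>Lexicographic product\<close>

definition lex_product ::
  "'a pair_pre_digraph \<Rightarrow> 'b pair_pre_digraph \<Rightarrow> ('a \<times> 'b) pair_pre_digraph" where
  "lex_product G H = \<lparr> pverts = pverts G \<times> pverts H,
     parcs = {((u, v), (x, y)) | u v x y.
                (u, v) \<in> pverts G \<times> pverts H \<and> (x, y) \<in> pverts G \<times> pverts H \<and>
                (u \<rightarrow>\<^bsub>G\<^esub> x \<or> u = x \<and> v \<rightarrow>\<^bsub>H\<^esub> y)} \<rparr>"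

lemma pair_graph_lex_product:
  assumes "pair_graph G" "pair_graph H"
  shows "pair_graph (lex_product G H)"
proof -
  interpret G: pair_graph G by fact
  interpret H: pair_graph H by fact
  have fin: "finite (pverts G \<times> pverts H)"
    using G.pair_finite_verts H.pair_finite_verts by simp
  have sub: "parcs (lex_product G H) \<subseteq> (pverts G \<times> pverts H) \<times> (pverts G \<times> pverts H)"
    by (auto simp: lex_product_def)
  have "finite (parcs (lex_product G H))"
    using fin sub by (meson finite_SigmaI finite_subset)
  moreover have "sym (parcs (lex_product G H))"
    using G.pair_sym_arcs H.pair_sym_arcs
    by (auto simp: lex_product_def symmetric_def sym_def)
  moreover have "fst e \<noteq> snd e" if "e \<in> parcs (lex_product G H)" for e
    using that G.pair_no_loops H.pair_no_loops by (force simp: lex_product_def)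
  ultimately show ?thesis
    using fin sub by unfold_locales (auto simp: lex_product_def symmetric_def)
qed

section \<open>The minima and the maximum are attained\<close>

lemma weak_roman_number_attained:
  "\<exists>f. weak_roman_dominating G f \<and> weight G f = weak_roman_number G"
proof -
  have "\<exists>f. weak_roman_dominating G f \<and> weight G f = weight G (\<lambda>_. 1)"
    by (rule exI[of _ "\<lambda>_. 1"]) (auto simp: weak_roman_dominating_def)
  then show ?thesis
    unfolding weak_roman_number_def by (rule LeastI)
qed

lemma double_total_number_attained:
  assumes "pair_graph G" "\<forall>v \<in> pverts G. 2 \<le> out_degree G v"
  shows "\<exists>S. double_total_dominating G S \<and> card S = double_total_number G"
proof -
  interpret pair_graph G by fact
  have "2 \<le> card {u \<in> pverts G. v \<rightarrow>\<^bsub>G\<^esub> u}" if "v \<in> pverts G" for v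
  proof -
    have "out_arcs G v = Pair v ` {u \<in> pverts G. v \<rightarrow>\<^bsub>G\<^esub> u}"
      by (auto simp: out_arcs_def in_arcsD2)
    then have "out_degree G v = card {u \<in> pverts G. v \<rightarrow>\<^bsub>G\<^esub> u}"
      by (simp add: out_degree_def card_image inj_on_def)
    with assms(2) that show ?thesis by metis
  qed
  then have "\<exists>S. double_total_dominating G S \<and> card S = card (pverts G)"
    by (intro exI[of _ "pverts G"]) (auto simp: double_total_dominating_def)
  then show ?thesis
    unfolding double_total_number_def by (rule LeastI)
qed

lemma packing_number_attained:
  assumes "pair_graph G"
  shows "\<exists>X. two_packing G X \<and> card X = packing_number G"
    and "two_packing G X \<Longrightarrow> card X \<le> packing_number G"
proof -
  interpret pair_graph G by fact
  have "{card X | X. two_packing G X} \<subseteq> card ` Pow (pverts G)"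
    by (auto simp: two_packing_def)
  then have fin: "finite {card X | X. two_packing G X}"
    using pair_finite_verts by (meson finite_Pow_iff finite_imageI finite_subset)
  have "two_packing G {}" by (simp add: two_packing_def)
  then have "{card X | X. two_packing G X} \<noteq> {}" by blast
  from Max_in[OF fin this] show "\<exists>X. two_packing G X \<and> card X = packing_number G"
    by (auto simp: packing_number_def)
  show "two_packing G X \<Longrightarrow> card X \<le> packing_number G"
    unfolding packing_number_def using fin by (intro Max_ge) auto
qed

end

theory Submission
  imports Defs
begin

text \<open>
  The upper bound places weight 1 on one copy of a double total dominating set: every vertex of
  the product then sees two units in neighbouring fibres, and moving one of them leaves it
  defended. For the lower bound, adding up the fibres (and truncating at 2) turns a weak Roman
  dominating function of the product into one of \<open>G\<close>; and if \<open>h\<^sub>1\<close>, \<open>h\<^sub>2\<close> are distinct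
  nonadjacent vertices of \<open>H\<close>, then one unit of weight on \<open>N[x] \<times> V(H)\<close> cannot serve both
  \<open>(x, h\<^sub>1)\<close> and \<open>(x, h\<^sub>2)\<close>, so each vertex of a 2-packing contributes at least 2.
\<close>

lemma weak_roman_number_le:
  "weak_roman_dominating G f \<Longrightarrow> weak_roman_number G \<le> weight G f"
  unfolding weak_roman_number_def by (rule Least_le) blast

lemma lex_product_verts [simp]: "pverts (lex_product G H) = pverts G \<times> pverts H"
  by (simp add: lex_product_def)

lemma lex_product_arcs [simp]:
  "((u, v), (x, y)) \<in> parcs (lex_product G H) \<longleftrightarrow>
     u \<in> pverts G \<and> v \<in> pverts H \<and> x \<in> pverts G \<and> y \<in> pverts H \<and>
     ((u, x) \<in> parcs G \<or> u = x \<and> (v, y) \<in> parcs H)"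
  by (auto simp: lex_product_def)

text \<open>The empty graph is complete with \<open>n = 0\<close>, so noncompleteness also provides
  a vertex of \<open>H\<close>.\<close>

lemma not_complete_digraphE:
  assumes "pair_graph H" "\<not> (\<exists>n. complete_digraph n H)"
  obtains h k where "h \<in> pverts H" "k \<in> pverts H" "h \<noteq> k" "(h, k) \<notin> parcs H" "(k, h) \<notin> parcs H"
proof -
  interpret H: pair_graph H by fact
  have "parcs H \<noteq> {(u, v). (u, v) \<in> pverts H \<times> pverts H \<and> u \<noteq> v}"
    using assms(2) H.pair_finite_verts complete_digraph_pair_def by blast
  moreover have "parcs H \<subseteq> {(u, v). (u, v) \<in> pverts H \<times> pverts H \<and> u \<noteq> v}"
    by (auto dest: H.in_arcsD1 H.in_arcsD2 H.no_loops')
  ultimately obtain h k where "h \<in> pverts H" "k \<in> pverts H" "h \<noteq> k" "(h, k) \<notin> parcs H"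
    by auto
  moreover have "(k, h) \<notin> parcs H"
    using calculation(4) H.pair_sym_arcs by (auto simp: symmetric_def sym_def)
  ultimately show thesis by (rule that)
qed

lemma weak_roman_number_lex_product_le_double_total:
  assumes G: "pair_graph G" and S: "double_total_dominating G S"
    and h0: "h0 \<in> pverts H" and H: "pair_graph H"
  shows "weak_roman_number (lex_product G H) \<le> card S"
proof -
  interpret G: pair_graph G by fact
  interpret H: pair_graph H by fact
  \<comment> \<open>Any \<open>h0\<close> works, since adjacency between different fibres ignores
    the second coordinate.\<close>
  define f where "f p = (if p \<in> S \<times> {h0} then 1 else 0 :: nat)" for p
  have SG: "S \<subseteq> pverts G" using S by (simp add: double_total_dominating_def)
  have two: "2 \<le> card {u \<in> S. (x, u) \<in> parcs G}" if "x \<in> pverts G" for x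
    using S that by (simp add: double_total_dominating_def)
  \<comment> \<open>The vertex \<open>w\<close> stands for the one that gives its unit away: a
    second neighbour in \<open>S\<close> always remains.\<close>
  have other: "\<exists>u \<in> S. (x, u) \<in> parcs G \<and> u \<noteq> w" if "x \<in> pverts G" for x w
  proof (rule ccontr)
    assume "\<not> ?thesis"
    then have "{u \<in> S. (x, u) \<in> parcs G} \<subseteq> {w}" by auto
    then have "card {u \<in> S. (x, u) \<in> parcs G} \<le> card {w}" by (intro card_mono) auto
    with two[OF that] show False by simp
  qed
  have "weak_roman_dominating (lex_product G H) f"
    unfolding weak_roman_dominating_def
  proof (intro conjI ballI impI)
    show "f \<in> pverts (lex_product G H) \<rightarrow> {0, 1, 2}" by (auto simp: f_def)
  next
    fix p assume p: "p \<in> pverts (lex_product G H)" and fp: "f p = 0"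
    obtain v h where ph: "p = (v, h)" "v \<in> pverts G" "h \<in> pverts H" using p by auto
    obtain u where u: "u \<in> S" "(v, u) \<in> parcs G" using other[OF ph(2)] by blast
    have "\<not> undefended (lex_product G H) (f(p := 1, (u, h0) := f (u, h0) - 1)) z" for z
    proof
      assume undef: "undefended (lex_product G H) (f(p := 1, (u, h0) := f (u, h0) - 1)) z"
      obtain x y where z: "z = (x, y)" "x \<in> pverts G" "y \<in> pverts H"
        using undef by (auto simp: undefended_def)
      obtain w where w: "w \<in> S" "(x, w) \<in> parcs G" "w \<noteq> u" using other[OF z(2)] by blast
      have "((x, y), (w, h0)) \<in> parcs (lex_product G H)" using w z h0 SG by auto
      then have "(f(p := 1, (u, h0) := f (u, h0) - 1)) (w, h0) = 0"
        using undef z unfolding undefended_def with_proj_simps by blast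
      then show False using w by (auto simp: f_def split: if_splits)
    qed
    moreover have "(p, (u, h0)) \<in> parcs (lex_product G H)" using ph u h0 SG by auto
    ultimately show "\<exists>q. p \<rightarrow>\<^bsub>lex_product G H\<^esub> q \<and> f q \<in> {1, 2} \<and>
        \<not> (\<exists>z. undefended (lex_product G H) (f(p := 1, q := f q - 1)) z)"
      using u(1) by (intro exI[of _ "(u, h0)"]) (auto simp: f_def)
  qed
  then have "weak_roman_number (lex_product G H) \<le> weight (lex_product G H) f"
    by (rule weak_roman_number_le)
  also have "\<dots> = (\<Sum>p \<in> S \<times> {h0}. 1)"
    unfolding weight_def f_def using SG h0 G.pair_finite_verts H.pair_finite_verts
    by (subst sum.inter_restrict[symmetric]) (auto intro!: arg_cong[where f = card])
  also have "\<dots> = card S" by (simp add: card_cartesian_product)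
  finally show ?thesis .
qed

text \<open>A vertex \<open>v\<close> with \<open>g v = 0\<close> has an empty fibre, so whatever
  defends \<open>(v, h)\<close> lies over a neighbour \<open>u\<close> of \<open>v\<close>. The same
  move in \<open>G\<close> works, because a vertex \<open>z\<close> left undefended there would
  leave \<open>(z, h)\<close> undefended in the product. Truncation at 2 keeps the values legal and
  never increases the weight.\<close>

lemma weak_roman_number_le_lex_product:
  assumes G: "pair_graph G" and H: "pair_graph H" and h: "h \<in> pverts H"
  shows "weak_roman_number G \<le> weak_roman_number (lex_product G H)"
proof -
  interpret G: pair_graph G by fact
  interpret H: pair_graph H by fact
  obtain f where f: "weak_roman_dominating (lex_product G H) f"
    and wf: "weight (lex_product G H) f = weak_roman_number (lex_product G H)"
    using weak_roman_number_attained by blast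
  define s where "s u = (\<Sum>k \<in> pverts H. f (u, k))" for u
  define g where "g u = min 2 (s u)" for u
  have g0: "f (u, k) = 0" if "g u = 0" "k \<in> pverts H" for u k
    using that H.pair_finite_verts by (auto simp: g_def s_def min_def split: if_splits)
  have "weak_roman_dominating G g"
    unfolding weak_roman_dominating_def
  proof (intro conjI ballI impI)
    show "g \<in> pverts G \<rightarrow> {0, 1, 2}" by (auto simp: g_def)
  next
    fix v assume v: "v \<in> pverts G" and gv: "g v = 0"
    have "(v, h) \<in> pverts (lex_product G H)" "f (v, h) = 0" using v h g0[OF gv] by auto
    then obtain q where q: "((v, h), q) \<in> parcs (lex_product G H)" "f q \<in> {1, 2}"
      "\<And>z. \<not> undefended (lex_product G H) (f((v, h) := 1, q := f q - 1)) z"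
      using f unfolding weak_roman_dominating_def with_proj_simps by blast
    obtain u k where uk: "q = (u, k)" by (cases q)
    have k: "k \<in> pverts H" "u \<in> pverts G" and "u \<noteq> v"
      using q g0[OF gv] uk by auto
    then have vu: "(v, u) \<in> parcs G" using q uk by auto
    have fle: "f (u, k) \<le> s u"
      unfolding s_def using k H.pair_finite_verts by (intro member_le_sum) auto
    then have gu: "g u \<in> {1, 2}" using q(2) uk by (auto simp: g_def min_def)
    have "\<not> undefended G (g(v := 1, u := g u - 1)) z" for z
    proof
      assume undef: "undefended G (g(v := 1, u := g u - 1)) z"
      have z: "z \<in> pverts G" "(g(v := 1, u := g u - 1)) z = 0"
        and nz: "\<And>w. (z, w) \<in> parcs G \<Longrightarrow> (g(v := 1, u := g u - 1)) w = 0"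
        using undef by (auto simp: undefended_def)
      \<comment> \<open>After the move \<open>v\<close> carries 1. So \<open>z\<close> is neither
        \<open>v\<close> nor adjacent to it, which also excludes \<open>u\<close>, a neighbour of
        \<open>v\<close>.\<close>
      have zv: "(z, v) \<notin> parcs G" "z \<noteq> v" using nz[of v] z(2) \<open>u \<noteq> v\<close> by auto
      have "z \<noteq> u"
        using zv vu G.pair_sym_arcs by (auto simp: symmetric_def sym_def)
      then have gz: "g z = 0" using z zv by simp
      have "(f((v, h) := 1, q := f q - 1)) (w, l) = 0"
        if w: "(z, w) \<in> parcs G \<or> w = z" and l: "l \<in> pverts H" for w l
      proof (cases "w = u")
        case False
        then have "g w = 0" "w \<noteq> v" using w nz[of w] gz zv by (auto split: if_splits)
        then show ?thesis using g0 l False uk by simp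
      next
        case True
        \<comment> \<open>Here \<open>z\<close> is adjacent to \<open>u\<close>, so \<open>u\<close>
          has nothing left. Hence truncation did not act at \<open>u\<close>, and the unit on
          \<open>(u, k)\<close> was the whole content of its fibre, which the move empties.\<close>
        then have "g u - 1 = 0" using w nz[of u] \<open>z \<noteq> u\<close> by auto
        then have "s u \<le> 1" by (auto simp: g_def min_def split: if_splits)
        moreover have "s u = f (u, k) + (\<Sum>j \<in> pverts H - {k}. f (u, j))"
          unfolding s_def using k H.pair_finite_verts by (simp add: sum.remove)
        ultimately have "f (u, k) \<le> 1" "(\<Sum>j \<in> pverts H - {k}. f (u, j)) = 0"
          using q(2) uk by auto
        then have "f (u, k) - 1 = 0" "\<And>j. j \<in> pverts H - {k} \<Longrightarrow> f (u, j) = 0"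
          using H.pair_finite_verts by auto
        then show ?thesis using True l uk \<open>u \<noteq> v\<close> by auto
      qed
      then have "undefended (lex_product G H) (f((v, h) := 1, q := f q - 1)) (z, h)"
        using z(1) h by (auto simp: undefended_def simp del: fun_upd_apply)
      with q(3) show False by blast
    qed
    then show "\<exists>u. v \<rightarrow>\<^bsub>G\<^esub> u \<and> g u \<in> {1, 2} \<and>
        \<not> (\<exists>z. undefended G (g(v := 1, u := g u - 1)) z)"
      using vu gu by auto
  qed
  then have "weak_roman_number G \<le> weight G g" by (rule weak_roman_number_le)
  also have "\<dots> \<le> (\<Sum>u \<in> pverts G. s u)"
    unfolding weight_def by (rule sum_mono) (simp add: g_def)
  also have "\<dots> = weight (lex_product G H) f"
    by (simp add: s_def weight_def sum.cartesian_product)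
  finally show ?thesis using wf by simp
qed

text \<open>All neighbours of vertices over \<open>x\<close> lie in the block \<open>?N\<close>. If
  the block carries at most one unit, defending an empty vertex over \<open>x\<close> brings that
  unit to this vertex, and a vertex over \<open>x\<close> not adjacent to it is left
  undefended.\<close>

lemma two_le_weight_closed_neighbourhood:
  assumes G: "pair_graph G" and H: "pair_graph H"
    and f: "weak_roman_dominating (lex_product G H) f" and x: "x \<in> pverts G"
    and hk: "h \<in> pverts H" "k \<in> pverts H" "h \<noteq> k" "(h, k) \<notin> parcs H" "(k, h) \<notin> parcs H"
  shows "2 \<le> (\<Sum>p \<in> closed_neighbourhood G x \<times> pverts H. f p)"
proof (rule ccontr)
  interpret G: pair_graph G by fact
  interpret H: pair_graph H by fact
  let ?N = "closed_neighbourhood G x \<times> pverts H"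
  assume "\<not> 2 \<le> (\<Sum>p \<in> ?N. f p)"
  then have le1: "(\<Sum>p \<in> ?N. f p) \<le> 1" by simp
  have "closed_neighbourhood G x \<subseteq> pverts G"
    using x G.in_arcsD2 by (auto simp: closed_neighbourhood_def)
  then have fin: "finite ?N"
    using G.pair_finite_verts H.pair_finite_verts by (meson finite_SigmaI finite_subset)
  have nbr: "p \<in> ?N" if "((x, a), p) \<in> parcs (lex_product G H)" for a p
    using that by (cases p) (auto simp: closed_neighbourhood_def)
  have unique: "f q = 0" if "p \<in> ?N" "f p \<noteq> 0" "q \<in> ?N" "q \<noteq> p" for p q
  proof -
    have "f p + f q = (\<Sum>r \<in> {p, q}. f r)" using that by simp
    also have "\<dots> \<le> (\<Sum>r \<in> ?N. f r)" using that fin by (intro sum_mono2) auto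
    finally show ?thesis using le1 that by simp
  qed
  \<comment> \<open>Stated for an arbitrary nonadjacent pair, since either of \<open>h\<close> and
    \<open>k\<close> may be the one whose copy over \<open>x\<close> is empty.\<close>
  have contra: False
    if ab: "a \<in> pverts H" "b \<in> pverts H" "a \<noteq> b" "(a, b) \<notin> parcs H" "(b, a) \<notin> parcs H"
      and fa: "f (x, a) = 0" for a b
  proof -
    have "(x, a) \<in> pverts (lex_product G H)" using x ab by simp
    then obtain q where q: "((x, a), q) \<in> parcs (lex_product G H)" "f q \<in> {1, 2}"
      "\<And>z. \<not> undefended (lex_product G H) (f((x, a) := 1, q := f q - 1)) z"
      using f fa unfolding weak_roman_dominating_def with_proj_simps by blast
    have qN: "q \<in> ?N" using q(1) nbr by blast
    have fq: "f q = 1"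
      using member_le_sum[OF qN, of f] le1 q(2) fin by auto
    have qb: "q \<noteq> (x, b)" using q(1) ab by (auto dest: G.no_loops')
    \<comment> \<open>The unit on \<open>q\<close> was the only one in the block, so after the move
      only \<open>(x, a)\<close> can carry weight there.\<close>
    have "(f((x, a) := 1, q := f q - 1)) r = 0" if "r \<in> ?N" "r \<noteq> (x, a)" for r
      using unique[OF qN _ that(1)] fq that by auto
    moreover have "(x, b) \<in> ?N" using ab by (simp add: closed_neighbourhood_def)
    moreover have "((x, b), (x, a)) \<notin> parcs (lex_product G H)"
      using ab by (auto dest: G.no_loops')
    ultimately have "undefended (lex_product G H) (f((x, a) := 1, q := f q - 1)) (x, b)"
      using x ab nbr[of b] by (auto simp: undefended_def simp del: fun_upd_apply lex_product_arcs)
    with q(3) show False by blast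
  qed
  \<comment> \<open>A single unit cannot occupy both vertices.\<close>
  have "f (x, h) = 0 \<or> f (x, k) = 0"
    using unique[of "(x, k)" "(x, h)"] hk(1-3) by (simp add: closed_neighbourhood_def) blast
  then show False using contra[of h k] contra[of k h] hk by auto
qed

lemma two_packing_le_weak_roman_number_lex_product:
  assumes G: "pair_graph G" and H: "pair_graph H" and X: "two_packing G X"
    and nc: "\<not> (\<exists>n. complete_digraph n H)"
  shows "2 * card X \<le> weak_roman_number (lex_product G H)"
proof -
  interpret G: pair_graph G by fact
  interpret H: pair_graph H by fact
  let ?N = "\<lambda>x. closed_neighbourhood G x \<times> pverts H"
  obtain h k where hk: "h \<in> pverts H" "k \<in> pverts H" "h \<noteq> k" "(h, k) \<notin> parcs H" "(k, h) \<notin> parcs H"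
    using not_complete_digraphE[OF H nc] .
  obtain f where f: "weak_roman_dominating (lex_product G H) f"
    and wf: "weight (lex_product G H) f = weak_roman_number (lex_product G H)"
    using weak_roman_number_attained by blast
  have XG: "X \<subseteq> pverts G" using X by (simp add: two_packing_def)
  have sub: "?N x \<subseteq> pverts G \<times> pverts H" if "x \<in> X" for x
    using that XG G.in_arcsD2 by (auto simp: closed_neighbourhood_def)
  have fin: "finite (pverts G \<times> pverts H)"
    using G.pair_finite_verts H.pair_finite_verts by simp
  have finN: "finite (?N x)" if "x \<in> X" for x using sub[OF that] fin finite_subset by blast
  have finX: "finite X" using XG G.pair_finite_verts finite_subset by blast
  have "2 * card X = (\<Sum>x \<in> X. 2)" by simp
  also have "\<dots> \<le> (\<Sum>x \<in> X. \<Sum>p \<in> ?N x. f p)"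
    using two_le_weight_closed_neighbourhood[OF G H f _ hk] XG by (intro sum_mono) blast
  \<comment> \<open>Closed neighbourhoods of a 2-packing are disjoint, hence so are the blocks over
    them, and no weight is counted twice.\<close>
  also have "\<dots> = (\<Sum>p \<in> (\<Union>x \<in> X. ?N x). f p)"
    using X finX finN unfolding two_packing_def
    by (intro sum.UNION_disjoint[symmetric]) (simp_all add: Times_Int_Times)
  also have "\<dots> \<le> weight (lex_product G H) f"
    unfolding weight_def using sub fin by (intro sum_mono2) auto
  finally show ?thesis using wf by simp
qed

theorem theorem31:
  fixes G :: "'a pair_pre_digraph" and H :: "'b pair_pre_digraph"
  assumes "pair_graph G"
    and "\<forall>v \<in> pverts G. 2 \<le> out_degree G v"
    and "double_total_number G = max (weak_roman_number G) (2 * packing_number G)"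
    and "pair_graph H"
    and "\<not> (\<exists>n. complete_digraph n H)"
  shows "weak_roman_number (lex_product G H) = double_total_number G"
proof (rule antisym)
  obtain h where h: "h \<in> pverts H" using not_complete_digraphE[OF assms(4,5)] .
  \<comment> \<open>Minimum degree two guarantees that a double total dominating set exists, so the
    minimum is attained.\<close>
  obtain S where "double_total_dominating G S" "card S = double_total_number G"
    using double_total_number_attained[OF assms(1,2)] by blast
  then show "weak_roman_number (lex_product G H) \<le> double_total_number G"
    using weak_roman_number_lex_product_le_double_total[OF assms(1) _ h assms(4)] by metis
  obtain X where "two_packing G X" "card X = packing_number G"
    using packing_number_attained(1)[OF assms(1)] by blast
  then have "2 * packing_number G \<le> weak_roman_number (lex_product G H)"
    using two_packing_le_weak_roman_number_lex_product[OF assms(1,4) _ assms(5)] by metis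
  \<comment> \<open>Both entries of the maximum are lower bounds for the product.\<close>
  then show "double_total_number G \<le> weak_roman_number (lex_product G H)"
    using weak_roman_number_le_lex_product[OF assms(1,4) h] assms(3) by simp
qed

end
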